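(* Let $p$ be an odd prime and $k\geq 1$ an integer. Then $C_{p^k}$ and $C_{p^k}\times C_p$ are $\mathrm{NCI}^{(2)}$-groups.
   Context: $C_n$ denotes the cyclic group of order $n$. Let $G$ be a finite group and $\mathrm{Sym}(G)$ the group of all permutations of the set $G$. Let $G_r\leq \mathrm{Sym}(G)$ be the group of all right translations $x\mapsto xg$, $g\in G$, and let $\mathrm{Hol}(G)=N_{\mathrm{Sym}(G)}(G_r)=G_r\rtimes \mathrm{Aut}(G)$. For $K\leq \mathrm{Sym}(G)$, the 2-closure $K^{(2)}$ is the largest subgroup of $\mathrm{Sym}(G)$ having the same orbits on $G\times G$ (under componentwise action) as $K$; $K$ is 2-closed if $K^{(2)}=K$. A subgroup of $\mathrm{Sym}(G)$ is $G$-regular if it is regular on $G$ and isomorphic to $G$. A group $K$ with $G_r\leq K\leq \mathrm{Sym}(G)$ is $G$-transjugate if every $G$-regular subgroup of $K$ is conjugate in $K$ to $G_r$. The group $G$ is an $\mathrm{NCI}^{(2)}$-group if every 2-closed group $K$ with $G_r\leq K\leq \mathrm{Hol}(G)$ is $G$-transjugate. *)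

theory Defs
  imports "HOL-Algebra.Algebra" "HOL-Computational_Algebra.Primes"
begin

text \<open>
  \<open>BijGroup S\<close> is \<open>Sym(S)\<close>, realised on the bijections of \<open>S\<close> that are
  extensional (\<open>undefined\<close> outside \<open>S\<close>). A permutation group on \<open>S\<close> is given by its
  carrier, a set \<open>K\<close> with \<open>subgroup K (BijGroup S)\<close>.
\<close>

abbreviation perm_group :: "'a set \<Rightarrow> ('a \<Rightarrow> 'a) set \<Rightarrow> ('a \<Rightarrow> 'a) monoid" where
  "perm_group S K \<equiv> (BijGroup S)\<lparr>carrier := K\<rparr>"

definition right_translations :: "('a, 'b) monoid_scheme \<Rightarrow> ('a \<Rightarrow> 'a) set" where
  "right_translations G = {\<lambda>x\<in>carrier G. x \<otimes>\<^bsub>G\<^esub> g | g. g \<in> carrier G}"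

definition holomorph :: "('a, 'b) monoid_scheme \<Rightarrow> ('a \<Rightarrow> 'a) set" where
  "holomorph G = normalizer (BijGroup (carrier G)) (right_translations G)"

definition pair_action :: "'a set \<Rightarrow> ('a \<Rightarrow> 'a) \<Rightarrow> 'a \<times> 'a \<Rightarrow> 'a \<times> 'a" where
  "pair_action S f = (\<lambda>z\<in>S \<times> S. (f (fst z), f (snd z)))"

definition two_orbits :: "'a set \<Rightarrow> ('a \<Rightarrow> 'a) set \<Rightarrow> ('a \<times> 'a) set set" where
  "two_orbits S K = orbits (perm_group S K) (S \<times> S) (pair_action S)"

text \<open>
  The greatest element is taken with respect to inclusion; \<open>two_closure_greatest\<close> below
  shows that it exists.
\<close>

definition two_closure :: "'a set \<Rightarrow> ('a \<Rightarrow> 'a) set \<Rightarrow> ('a \<Rightarrow> 'a) set" where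
  "two_closure S K =
    (GREATEST L. subgroup L (BijGroup S) \<and> two_orbits S L = two_orbits S K)"

definition two_closed :: "'a set \<Rightarrow> ('a \<Rightarrow> 'a) set \<Rightarrow> bool" where
  "two_closed S K \<longleftrightarrow> two_closure S K = K"

definition regular_on :: "'a set \<Rightarrow> ('a \<Rightarrow> 'a) set \<Rightarrow> bool" where
  "regular_on S R \<longleftrightarrow>
    (\<forall>x\<in>S. orbit (perm_group S R) (\<lambda>f. f) x = S \<and>
            stabilizer (perm_group S R) (\<lambda>f. f) x = {\<one>\<^bsub>BijGroup S\<^esub>})"

definition G_regular :: "('a, 'b) monoid_scheme \<Rightarrow> ('a \<Rightarrow> 'a) set \<Rightarrow> bool" where
  "G_regular G R \<longleftrightarrow>
    subgroup R (BijGroup (carrier G)) \<and> regular_on (carrier G) R \<and>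
    perm_group (carrier G) R \<cong> G"

definition conjugate_in :: "('a, 'b) monoid_scheme \<Rightarrow> 'a set \<Rightarrow> 'a set \<Rightarrow> 'a set \<Rightarrow> bool" where
  "conjugate_in M K A B \<longleftrightarrow> (\<exists>k\<in>K. A = (k <#\<^bsub>M\<^esub> B) #>\<^bsub>M\<^esub> inv\<^bsub>M\<^esub> k)"

definition transjugate :: "('a, 'b) monoid_scheme \<Rightarrow> ('a \<Rightarrow> 'a) set \<Rightarrow> bool" where
  "transjugate G K \<longleftrightarrow>
    subgroup K (BijGroup (carrier G)) \<and> right_translations G \<subseteq> K \<and>
    (\<forall>R. G_regular G R \<and> R \<subseteq> K \<longrightarrow>
         conjugate_in (BijGroup (carrier G)) K R (right_translations G))"

definition NCI2_group :: "('a, 'b) monoid_scheme \<Rightarrow> bool" where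
  "NCI2_group G \<longleftrightarrow>
    group G \<and> finite (carrier G) \<and>
    (\<forall>K. subgroup K (BijGroup (carrier G)) \<and> two_closed (carrier G) K \<and>
         right_translations G \<subseteq> K \<and> K \<subseteq> holomorph G \<longrightarrow> transjugate G K)"


lemma Bij_app: "f \<in> Bij S \<Longrightarrow> x \<in> S \<Longrightarrow> f x \<in> S"
  using Bij_imp_funcset by fastforce

lemma mult_BijGroup_app:
  "f \<in> Bij S \<Longrightarrow> g \<in> Bij S \<Longrightarrow> x \<in> S \<Longrightarrow> (f \<otimes>\<^bsub>BijGroup S\<^esub> g) x = f (g x)"
  by (simp add: BijGroup_def compose_def)

lemma perm_one: "subgroup K (BijGroup S) \<Longrightarrow> (\<lambda>x\<in>S. x) \<in> K"
  using subgroup.one_closed[of K "BijGroup S"] by (simp add: BijGroup_def)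

lemma perm_Bij: "subgroup K (BijGroup S) \<Longrightarrow> K \<subseteq> Bij S"
  using subgroup.subset[of K "BijGroup S"] by (simp add: BijGroup_def)

lemma perm_mult:
  assumes "subgroup K (BijGroup S)" "f \<in> K" "g \<in> K"
  shows "\<exists>h\<in>K. \<forall>x\<in>S. h x = f (g x)"
  using subgroup.m_closed[OF assms] mult_BijGroup_app perm_Bij[OF assms(1)] assms(2,3)
  by (metis subsetD)

lemma perm_inv:
  assumes "subgroup K (BijGroup S)" "f \<in> K"
  shows "\<exists>h\<in>K. (\<forall>x\<in>S. h (f x) = x) \<and> (\<forall>x\<in>S. f (h x) = x)"
proof -
  have f: "f \<in> Bij S" using assms perm_Bij by blast
  have "restrict (inv_into S f) S \<in> K"
    using subgroup.m_inv_closed[OF assms] inv_BijGroup[OF f] by simp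
  moreover have "bij_betw f S S" using f by (simp add: Bij_def)
  ultimately show ?thesis
    by (intro bexI[of _ "restrict (inv_into S f) S"])
       (auto simp: bij_betw_def inv_into_f_f f_inv_into_f Bij_app[OF f])
qed

lemma orbit_pair_action:
  "x \<in> S \<Longrightarrow> y \<in> S \<Longrightarrow>
    orbit (perm_group S K) (pair_action S) (x, y) = {(k x, k y) | k. k \<in> K}"
  by (simp add: orbit_def pair_action_def)

lemma two_orbits_alt:
  "two_orbits S K = (\<lambda>(x, y). {(k x, k y) | k. k \<in> K}) ` (S \<times> S)"
proof -
  have "two_orbits S K = orbit (perm_group S K) (pair_action S) ` (S \<times> S)"
    unfolding two_orbits_def orbits_def by blast
  also have "\<dots> = (\<lambda>(x, y). {(k x, k y) | k. k \<in> K}) ` (S \<times> S)"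
    by (rule image_cong) (auto simp: orbit_pair_action)
  finally show ?thesis .
qed

lemma two_orbits_eq_iff:
  assumes K: "subgroup K (BijGroup S)" and L: "subgroup L (BijGroup S)"
  shows "two_orbits S L = two_orbits S K \<longleftrightarrow>
    (\<forall>x\<in>S. \<forall>y\<in>S. {(k x, k y) | k. k \<in> L} = {(k x, k y) | k. k \<in> K})"
    (is "?l \<longleftrightarrow> ?r")
proof
  assume ?r
  then show ?l unfolding two_orbits_alt by (intro image_cong refl) (elim SigmaE, simp)
next
  assume eq: ?l
  show ?r
  proof (intro ballI)
    fix x y assume xy: "x \<in> S" "y \<in> S"
    let ?O = "\<lambda>K x y. {(k x, k y) | k. k \<in> K}"
    have "?O K x y \<in> two_orbits S K"
      using xy unfolding two_orbits_alt by (intro image_eqI[of _ _ "(x, y)"]) simp_all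
    then have "?O K x y \<in> two_orbits S L" by (simp only: eq)
    then obtain u v where uv: "u \<in> S" "v \<in> S" "?O K x y = ?O L u v"
      unfolding two_orbits_alt by auto
    have "(x, y) \<in> ?O K x y"
      using perm_one[OF K] xy by (auto intro!: exI[of _ "\<lambda>x\<in>S. x"])
    then obtain l where l: "l \<in> L" "x = l u" "y = l v" unfolding uv by auto
    obtain l' where l': "l' \<in> L" "\<forall>x\<in>S. l' (l x) = x" using perm_inv[OF L l(1)] by auto
    have "?O L x y \<subseteq> ?O L u v"
    proof
      fix z assume "z \<in> ?O L x y"
      then obtain k where k: "k \<in> L" "z = (k x, k y)" by auto
      obtain h where "h \<in> L" "\<forall>x\<in>S. h x = k (l x)" using perm_mult[OF L k(1) l(1)] by auto
      then show "z \<in> ?O L u v" using k uv(1,2) l by (auto intro!: exI[of _ h])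
    qed
    moreover have "?O L u v \<subseteq> ?O L x y"
    proof
      fix z assume "z \<in> ?O L u v"
      then obtain k where k: "k \<in> L" "z = (k u, k v)" by auto
      obtain h where "h \<in> L" "\<forall>x\<in>S. h x = k (l' x)" using perm_mult[OF L k(1) l'(1)] by auto
      then show "z \<in> ?O L x y" using k uv(1,2) l l' xy by (auto intro!: exI[of _ h])
    qed
    ultimately show "?O L x y = ?O K x y" using uv by simp
  qed
qed

definition two_hull :: "'a set \<Rightarrow> ('a \<Rightarrow> 'a) set \<Rightarrow> ('a \<Rightarrow> 'a) set" where
  "two_hull S K = {f \<in> Bij S. \<forall>x\<in>S. \<forall>y\<in>S. \<exists>k\<in>K. f x = k x \<and> f y = k y}"

lemma subgroup_two_hull:
  assumes K: "subgroup K (BijGroup S)"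
  shows "subgroup (two_hull S K) (BijGroup S)"
proof (rule group.subgroupI[OF group_BijGroup])
  show "two_hull S K \<subseteq> carrier (BijGroup S)" by (auto simp: two_hull_def BijGroup_def)
  show "two_hull S K \<noteq> {}"
    using perm_one[OF K] id_Bij unfolding two_hull_def by fastforce
next
  fix f assume f: "f \<in> two_hull S K"
  then have fB: "f \<in> Bij S" by (simp add: two_hull_def)
  let ?g = "restrict (inv_into S f) S"
  have gB: "?g \<in> Bij S" by (rule restrict_inv_into_Bij[OF fB])
  have "\<exists>k\<in>K. ?g x = k x \<and> ?g y = k y" if xy: "x \<in> S" "y \<in> S" for x y
  proof -
    have g: "?g x \<in> S" "?g y \<in> S" using Bij_app[OF gB] xy by blast+
    then obtain k where k: "k \<in> K" "f (?g x) = k (?g x)" "f (?g y) = k (?g y)"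
      using f unfolding two_hull_def by blast
    have "f (?g x) = x" "f (?g y) = y"
      using xy fB by (auto simp: Bij_def bij_betw_def f_inv_into_f)
    moreover obtain h where "h \<in> K" "\<forall>x\<in>S. h (k x) = x" using perm_inv[OF K k(1)] by auto
    ultimately show ?thesis using k g by metis
  qed
  then show "inv\<^bsub>BijGroup S\<^esub> f \<in> two_hull S K"
    using gB inv_BijGroup[OF fB] unfolding two_hull_def by simp
next
  fix f g assume f: "f \<in> two_hull S K" and g: "g \<in> two_hull S K"
  then have B: "f \<in> Bij S" "g \<in> Bij S" by (auto simp: two_hull_def)
  have "\<exists>k\<in>K. f (g x) = k x \<and> f (g y) = k y" if xy: "x \<in> S" "y \<in> S" for x y
  proof -
    obtain k where k: "k \<in> K" "g x = k x" "g y = k y"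
      using g xy unfolding two_hull_def by blast
    obtain l where l: "l \<in> K" "f (g x) = l (g x)" "f (g y) = l (g y)"
      using f Bij_app[OF B(2)] xy unfolding two_hull_def by blast
    obtain h where "h \<in> K" "\<forall>x\<in>S. h x = l (k x)" using perm_mult[OF K l(1) k(1)] by auto
    then show ?thesis using k l xy by (intro bexI[of _ h]) auto
  qed
  moreover have "f \<otimes>\<^bsub>BijGroup S\<^esub> g \<in> Bij S"
    using B by (simp add: BijGroup_def compose_Bij)
  ultimately show "f \<otimes>\<^bsub>BijGroup S\<^esub> g \<in> two_hull S K"
    using B by (simp add: two_hull_def mult_BijGroup_app)
qed

lemma two_orbits_two_hull:
  assumes K: "subgroup K (BijGroup S)"
  shows "two_orbits S (two_hull S K) = two_orbits S K"
  unfolding two_orbits_eq_iff[OF K subgroup_two_hull[OF K]]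
proof (intro ballI subset_antisym)
  fix x y assume "x \<in> S" "y \<in> S"
  then show "{(k x, k y) | k. k \<in> two_hull S K} \<subseteq> {(k x, k y) | k. k \<in> K}"
    by (force simp: two_hull_def)
  have "K \<subseteq> two_hull S K" using perm_Bij[OF K] unfolding two_hull_def by blast
  then show "{(k x, k y) | k. k \<in> K} \<subseteq> {(k x, k y) | k. k \<in> two_hull S K}" by auto
qed

lemma subset_two_hull:
  assumes K: "subgroup K (BijGroup S)"
    and L: "subgroup L (BijGroup S)" "two_orbits S L = two_orbits S K"
  shows "L \<subseteq> two_hull S K"
proof
  fix f assume f: "f \<in> L"
  have "\<exists>k\<in>K. f x = k x \<and> f y = k y" if "x \<in> S" "y \<in> S" for x y
  proof -
    have "(f x, f y) \<in> {(k x, k y) | k. k \<in> L}" using f by blast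
    also have "\<dots> = {(k x, k y) | k. k \<in> K}"
      using two_orbits_eq_iff[OF K L(1)] L(2) that by simp
    finally show ?thesis by auto
  qed
  then show "f \<in> two_hull S K" using perm_Bij[OF L(1)] f by (auto simp: two_hull_def)
qed

lemma two_closure_eq_two_hull:
  assumes K: "subgroup K (BijGroup S)"
  shows "two_closure S K = two_hull S K"
  unfolding two_closure_def
  by (rule Greatest_equality)
     (use K subgroup_two_hull two_orbits_two_hull subset_two_hull in blast)+

lemma two_closure_greatest:
  assumes "subgroup K (BijGroup S)"
  shows "subgroup (two_closure S K) (BijGroup S)"
    and "two_orbits S (two_closure S K) = two_orbits S K"
    and "\<lbrakk>subgroup L (BijGroup S); two_orbits S L = two_orbits S K\<rbrakk> \<Longrightarrow> L \<subseteq> two_closure S K"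
  using assms subgroup_two_hull two_orbits_two_hull subset_two_hull
  by (simp_all add: two_closure_eq_two_hull)

end

theory Submission
  imports Defs
begin

text \<open>
  Write \<open>G\<close> for either group and let \<open>K\<close> be a 2-closed group between the right translations
  and the holomorph. The proof shows more than transjugacy: every \<open>G\<close>-regular subgroup \<open>R\<close> of
  \<open>K\<close> is equal to the group of right translations.

  Since \<open>R\<close> is abelian and regular, each \<open>g\<close> is the image of \<open>\<one>\<close> under exactly one \<open>r\<^sub>g \<in> R\<close>, and
  \<open>r\<^sub>g(h) = g \<otimes> h \<otimes> M g h\<close> defines a function \<open>M\<close>. As the elements of the holomorph are affine
  and \<open>R\<close> is commutative, \<open>M\<close> is a commutative associative bilinear multiplication, which makes
  \<open>G\<close> a radical ring whose circle operation is the group law of \<open>R\<close>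
  (\<open>regular_subgroup_radical_ring\<close>). The automorphisms \<open>h \<mapsto> h \<otimes> M g h\<close> all belong to \<open>K\<close>, and
  \<open>R\<close> consists of translations exactly when \<open>M\<close> is trivial.

  Suppose that \<open>M\<close> is not trivial. A nonzero multiplication map \<open>N = M g\<close> with the largest
  possible kernel satisfies \<open>N\<^sup>2 = 0\<close> and \<open>pN = 0\<close>, because \<open>N\<^sup>2\<close> and \<open>pN\<close> are again
  multiplication maps, with a strictly larger kernel since \<open>N\<close> and \<open>p\<close> act nilpotently
  (\<open>exists_square_zero_multiplication\<close>). In \<open>C\<^sub>n\<close> and \<open>C\<^sub>n \<times> C\<^sub>p\<close> with \<open>n = p\<^sup>k\<close>, such an \<open>N\<close> has
  cyclic image: \<open>N v\<close> is the power of a fixed \<open>w\<close> of order \<open>p\<close> with exponent \<open>\<lambda> v\<close>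
  (\<open>square_zero_endo_rank_one\<close>).

  This is where 2-closedness enters. The quadratic map \<open>f v = v \<otimes> w\<^bsup>(\<lambda> v)\<^sup>2\<^esup>\<close> satisfies,
  because of \<open>a\<^sup>2 - b\<^sup>2 = (a + b) (a - b)\<close>,
  \<open>f u / f v = (1 + N)\<^bsup>\<lambda> u + \<lambda> v\<^esup> (u / v)\<close>, so that on each pair of points it agrees with an element
  of \<open>K\<close> (\<open>quadratic_shear_in_two_hull\<close>). Hence \<open>f\<close> lies in \<open>K\<close> and is affine. As \<open>p\<close> is odd, a
  quadratic map is affine only if \<open>\<lambda> = 0\<close> modulo \<open>p\<close>, which contradicts \<open>N \<noteq> 0\<close>
  (\<open>no_square_zero_rank_one_shear\<close>).
\<close>

section \<open>Affine maps\<close>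

lemma (in group) right_translation_Bij:
  assumes "g \<in> carrier G"
  shows "(\<lambda>x\<in>carrier G. x \<otimes> g) \<in> Bij (carrier G)"
proof -
  have "bij_betw (\<lambda>x. x \<otimes> g) (carrier G) (carrier G)"
    by (rule bij_betw_byWitness[where f' = "\<lambda>x. x \<otimes> inv g"]) (use assms in \<open>auto simp: m_assoc\<close>)
  then show ?thesis by (simp add: Bij_def cong: bij_betw_cong)
qed

text \<open>
  If \<open>f\<close> conjugates the translation by \<open>y\<close> to the translation by \<open>g\<close>, then
  \<open>f (z \<otimes> y) = f z \<otimes> g\<close>, and the case \<open>z = \<one>\<close> determines \<open>g\<close>.
\<close>

lemma (in group) holomorph_affine:
  assumes f: "f \<in> holomorph G" and x: "x \<in> carrier G" and y: "y \<in> carrier G"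
  shows "f (x \<otimes> y) = f x \<otimes> (inv (f \<one>) \<otimes> f y)"
proof -
  let ?S = "carrier G" and ?B = "BijGroup (carrier G)"
  let ?T = "right_translations G"
  interpret B: group ?B by (rule group_BijGroup)
  have TB: "?T \<subseteq> carrier ?B"
    using right_translation_Bij by (auto simp: right_translations_def BijGroup_def)
  have fB: "f \<in> carrier ?B" and fT: "f <#\<^bsub>?B\<^esub> ?T #>\<^bsub>?B\<^esub> (inv\<^bsub>?B\<^esub> f) = ?T"
    using f TB by (auto simp: holomorph_def normalizer_def stabilizer_def)
  have fBij: "f \<in> Bij ?S" using fB by (simp add: BijGroup_def)
  define t where "t = (\<lambda>x\<in>?S. x \<otimes> y)"
  have tT: "t \<in> ?T" using y by (auto simp: right_translations_def t_def)
  then have tB: "t \<in> carrier ?B" using TB by blast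
  have "f \<otimes>\<^bsub>?B\<^esub> t \<otimes>\<^bsub>?B\<^esub> inv\<^bsub>?B\<^esub> f \<in> f <#\<^bsub>?B\<^esub> ?T #>\<^bsub>?B\<^esub> (inv\<^bsub>?B\<^esub> f)"
    using tT by (auto simp: l_coset_def r_coset_def)
  then obtain g where g: "g \<in> ?S" and
    eq: "f \<otimes>\<^bsub>?B\<^esub> t \<otimes>\<^bsub>?B\<^esub> inv\<^bsub>?B\<^esub> f = (\<lambda>x\<in>?S. x \<otimes> g)" (is "_ = ?u")
    unfolding fT by (auto simp: right_translations_def)
  have uB: "?u \<in> carrier ?B" using right_translation_Bij[OF g] by (simp add: BijGroup_def)
  have "f \<otimes>\<^bsub>?B\<^esub> t = ?u \<otimes>\<^bsub>?B\<^esub> f"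
    using eq fB tB uB by (metis B.inv_solve_right' B.m_closed)
  then have "(f \<otimes>\<^bsub>?B\<^esub> t) z = (?u \<otimes>\<^bsub>?B\<^esub> f) z" for z by simp
  then have *: "f (z \<otimes> y) = f z \<otimes> g" if "z \<in> ?S" for z
    using mult_BijGroup_app[of f ?S t z] mult_BijGroup_app[of ?u ?S f z] that fBij tB uB
      Bij_app[OF fBij that]
    by (simp add: BijGroup_def t_def)
  have "f y = f \<one> \<otimes> g" using *[of \<one>] y by simp
  then have "inv (f \<one>) \<otimes> f y = g"
    using g Bij_app[OF fBij one_closed] by (simp add: m_assoc[symmetric])
  then show ?thesis using *[OF x] by simp
qed

section \<open>Quadratic shears in the 2-closure\<close>

text \<open>As \<open>N\<^sup>2 = 0\<close>, the \<open>m\<close>-th power of \<open>1 + N\<close> is \<open>1 + m N\<close>.\<close>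

lemma (in comm_group) shear_power_in_perm_group:
  assumes K: "subgroup K (BijGroup (carrier G))"
    and N: "N \<in> hom G G" and NN: "\<And>z. z \<in> carrier G \<Longrightarrow> N (N z) = \<one>"
    and NK: "\<exists>k\<in>K. \<forall>z\<in>carrier G. k z = z \<otimes> N z"
  shows "\<exists>k\<in>K. \<forall>z\<in>carrier G. k z = z \<otimes> N z [^] (m::nat)"
proof (induction m)
  case 0
  show ?case using perm_one[OF K] by (intro bexI[of _ "\<lambda>x\<in>carrier G. x"]) auto
next
  case (Suc m)
  then obtain k where k: "k \<in> K" "\<forall>z\<in>carrier G. k z = z \<otimes> N z [^] m" by blast
  obtain l where l: "l \<in> K" "\<forall>z\<in>carrier G. l z = z \<otimes> N z" using NK by blast
  obtain h where h: "h \<in> K" "\<forall>z\<in>carrier G. h z = k (l z)" using perm_mult[OF K k(1) l(1)] by blast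
  have "h z = z \<otimes> N z [^] Suc m" if z: "z \<in> carrier G" for z
  proof -
    have Nz: "N z \<in> carrier G" using N z by (rule hom_in_carrier)
    have "N (z \<otimes> N z) = N z" using hom_mult[OF N z Nz] NN[OF z] Nz by simp
    then show ?thesis using h(2) k(2) l(2) z Nz by (simp add: m_ac)
  qed
  then show ?case using h(1) by blast
qed

text \<open>
  For two points \<open>u\<close> and \<open>v\<close>, the map \<open>z \<mapsto> (1 + N)\<^bsup>\<lambda> u + \<lambda> v\<^esup> z \<otimes> w\<^bsup>-(\<lambda> u \<cdot> \<lambda> v)\<^esup>\<close> belongs to \<open>K\<close> and
  interpolates the quadratic map at both.
\<close>

lemma (in comm_group) quadratic_shear_in_two_hull:
  fixes lam :: "'a \<Rightarrow> nat"
  assumes fin: "finite (carrier G)"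
    and K: "subgroup K (BijGroup (carrier G))" and TK: "right_translations G \<subseteq> K"
    and N: "N \<in> hom G G" and NN: "\<And>z. z \<in> carrier G \<Longrightarrow> N (N z) = \<one>"
    and NK: "\<exists>k\<in>K. \<forall>z\<in>carrier G. k z = z \<otimes> N z"
    and w: "w \<in> carrier G" and lam: "\<And>v. v \<in> carrier G \<Longrightarrow> N v = w [^] lam v"
  shows "(\<lambda>v\<in>carrier G. v \<otimes> w [^] (lam v * lam v)) \<in> two_hull (carrier G) K"
proof -
  let ?S = "carrier G"
  define f where "f = (\<lambda>v\<in>?S. v \<otimes> w [^] (lam v * lam v))"
  have loc: "\<exists>k\<in>K. f u = k u \<and> f v = k v" if u: "u \<in> ?S" and v: "v \<in> ?S" for u v
  proof -
    obtain l where l: "l \<in> K" "\<forall>z\<in>?S. l z = z \<otimes> N z [^] (lam u + lam v)"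
      using shear_power_in_perm_group[OF K N NN NK] by blast
    let ?c = "inv (w [^] (lam u * lam v))"
    have "(\<lambda>x\<in>?S. x \<otimes> ?c) \<in> right_translations G" using w by (auto simp: right_translations_def)
    then have "(\<lambda>x\<in>?S. x \<otimes> ?c) \<in> K" using TK by blast
    from perm_mult[OF K this l(1)]
    obtain k where k: "k \<in> K" "\<forall>z\<in>?S. k z = (\<lambda>x\<in>?S. x \<otimes> ?c) (l z)" by blast
    \<comment> \<open>The identities \<open>a (a + b) - a b = a\<^sup>2\<close> and \<open>b (a + b) - a b = b\<^sup>2\<close> in the exponent of \<open>w\<close>.\<close>
    have "k z = z \<otimes> w [^] (lam z * (lam u + lam v)) \<otimes> ?c" if "z \<in> ?S" for z
      using k(2) l(2) that w lam[OF that] by (simp add: nat_pow_pow)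
    moreover have "z \<otimes> w [^] (i + j) \<otimes> inv (w [^] j) = z \<otimes> w [^] i"
      if "z \<in> ?S" for z and i j :: nat
      using that w by (simp add: nat_pow_mult[symmetric] m_assoc)
    moreover have "lam u * (lam u + lam v) = lam u * lam u + lam u * lam v"
      and "lam v * (lam u + lam v) = lam v * lam v + lam u * lam v"
      by (simp_all add: algebra_simps)
    ultimately have "f u = k u \<and> f v = k v" using u v by (simp add: f_def)
    then show ?thesis using k(1) by blast
  qed
  have fS: "f ` ?S \<subseteq> ?S" using w by (auto simp: f_def)
  have "inj_on f ?S"
  proof (rule inj_onI)
    fix u v assume uv: "u \<in> ?S" "v \<in> ?S" "f u = f v"
    then obtain k where k: "k \<in> K" "k u = k v" using loc[of u v] by auto
    then have "inj_on k ?S" using perm_Bij[OF K] by (auto simp: Bij_def bij_betw_def)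
    then show "u = v" using k uv by (auto dest: inj_onD)
  qed
  then have "bij_betw f ?S ?S" using endo_inj_surj[OF fin fS] by (simp add: bij_betw_def)
  then have "f \<in> Bij ?S" by (simp add: Bij_def f_def)
  then have "f \<in> two_hull ?S K" using loc by (simp add: two_hull_def)
  then show ?thesis by (simp add: f_def)
qed

text \<open>
  The quadratic shear \<open>f\<close> belongs to the 2-closed group \<open>K\<close> and fixes \<open>\<one>\<close>, so it is additive.
  Comparing \<open>f (u \<otimes> u)\<close> with \<open>f u \<otimes> f u\<close> gives \<open>(2a)\<^sup>2 = 2a\<^sup>2\<close> modulo \<open>p\<close> for the exponent \<open>a = \<lambda> u\<close>,
  and \<open>2\<close> is invertible modulo \<open>p\<close>.
\<close>

lemma (in comm_group) no_square_zero_rank_one_shear: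
  fixes p :: nat and lam :: "'a \<Rightarrow> nat"
  assumes fin: "finite (carrier G)" and p: "Factorial_Ring.prime p" "odd p"
    and K: "subgroup K (BijGroup (carrier G))" and TK: "right_translations G \<subseteq> K"
    and KH: "K \<subseteq> holomorph G" and closed: "two_closed (carrier G) K"
    and N: "N \<in> hom G G" and NN: "\<And>z. z \<in> carrier G \<Longrightarrow> N (N z) = \<one>"
    and NK: "\<exists>k\<in>K. \<forall>z\<in>carrier G. k z = z \<otimes> N z"
    and w: "w \<in> carrier G" "w [^] p = \<one>" and lam: "\<And>v. v \<in> carrier G \<Longrightarrow> N v = w [^] lam v"
    and u: "u \<in> carrier G"
  shows "N u = \<one>"
proof (rule ccontr)
  assume Nu: "N u \<noteq> \<one>"
  define f where "f = (\<lambda>v\<in>carrier G. v \<otimes> w [^] (lam v * lam v))"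
  have "f \<in> two_hull (carrier G) K"
    unfolding f_def by (rule quadratic_shear_in_two_hull[OF fin K TK N NN NK w(1) lam])
  then have fH: "f \<in> holomorph G"
    using closed KH two_closure_eq_two_hull[OF K] by (auto simp: two_closed_def)
  have f1: "f \<one> = \<one>"
  proof -
    have "w [^] lam \<one> = \<one>"
      using lam[of \<one>] hom_one[OF N is_group is_group] by simp
    then have "w [^] (lam \<one> * lam \<one>) = \<one>" using w by (metis nat_pow_one nat_pow_pow)
    then show ?thesis by (simp add: f_def)
  qed
  let ?a = "lam u" and ?b = "lam (u \<otimes> u)"
  have "w [^] ?b = w [^] (2 * ?a)"
    using hom_mult[OF N u u] lam u w by (simp add: nat_pow_mult mult_2)
  then have "w [^] (?b * ?b) = w [^] (2 * ?a * (2 * ?a))"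
    using w by (metis mult.commute nat_pow_pow)
  then have sq: "w [^] (?b * ?b) = w [^] (2 * (?a * ?a)) \<otimes> w [^] (2 * (?a * ?a))"
    using w by (simp add: nat_pow_mult algebra_simps)
  have "f (u \<otimes> u) = f u \<otimes> f u"
    using holomorph_affine[OF fH u u] f1 u w by (simp add: f_def)
  then have "u \<otimes> u \<otimes> w [^] (?b * ?b) = u \<otimes> u \<otimes> w [^] (2 * (?a * ?a))"
    using u w by (simp add: f_def m_ac nat_pow_mult[symmetric] mult_2)
  then have "w [^] (?b * ?b) = w [^] (2 * (?a * ?a))" using u w by simp
  then have "w [^] (2 * (?a * ?a)) = \<one>" using sq w by simp
  moreover have ow: "ord w = p"
  proof -
    have "ord w dvd p" using w pow_eq_id by blast
    moreover have "ord w \<noteq> 1" using Nu lam[OF u] ord_eq_1[OF w(1)] by auto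
    ultimately show ?thesis using p(1) by (metis prime_nat_iff)
  qed
  ultimately have "p dvd 2 * (?a * ?a)" using w pow_eq_id by blast
  moreover have "\<not> p dvd 2"
    using p by (metis primes_dvd_imp_eq two_is_prime_nat even_numeral)
  ultimately have "p dvd ?a" using p(1) by (simp add: prime_dvd_mult_iff)
  then have "N u = \<one>" using lam[OF u] w ow pow_eq_id by simp
  then show False using Nu by simp
qed

section \<open>Regular subgroups as radical rings\<close>

text \<open>
  Below, \<open>c g\<close> is the element of \<open>R\<close> that sends \<open>\<one>\<close> to \<open>g\<close>. Then \<open>(g, h) \<mapsto> c g h\<close> is the group law of
  \<open>R\<close> transported to \<open>G\<close>, and \<open>M\<close> measures its deviation from the group law of \<open>G\<close>. Additivity of
  \<open>M\<close> in the second argument is the affinity of \<open>c g\<close>; commutativity of \<open>R\<close> gives symmetry, hence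
  additivity in the first argument as well, and then associativity of \<open>M\<close> is read off from
  associativity of \<open>c\<close>. The fourth property, injectivity of \<open>h \<mapsto> h \<otimes> M g h\<close>, says
  that every element of the ring is quasi-regular.
\<close>

lemma (in comm_group) regular_subgroup_radical_ring:
  assumes K: "subgroup K (BijGroup (carrier G))" and TK: "right_translations G \<subseteq> K"
    and KH: "K \<subseteq> holomorph G" and R: "G_regular G R" "R \<subseteq> K"
  obtains M where "\<And>g. g \<in> carrier G \<Longrightarrow> M g \<in> hom G G"
    and "\<And>g h. g \<in> carrier G \<Longrightarrow> h \<in> carrier G \<Longrightarrow> M g h = M h g"
    and "\<And>g h x. g \<in> carrier G \<Longrightarrow> h \<in> carrier G \<Longrightarrow> x \<in> carrier G \<Longrightarrow>
           M (M g h) x = M g (M h x)"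
    and "\<And>g h. g \<in> carrier G \<Longrightarrow> h \<in> carrier G \<Longrightarrow> h \<otimes> M g h = \<one> \<Longrightarrow> h = \<one>"
    and "\<And>g. g \<in> carrier G \<Longrightarrow> \<exists>k\<in>K. \<forall>z\<in>carrier G. k z = z \<otimes> M g z"
    and "(\<forall>g\<in>carrier G. \<forall>h\<in>carrier G. M g h = \<one>) \<Longrightarrow> R = right_translations G"
proof -
  let ?S = "carrier G" and ?B = "BijGroup (carrier G)"
  have RB: "subgroup R ?B" and reg: "regular_on ?S R" and iso: "perm_group ?S R \<cong> G"
    using R(1) by (simp_all add: G_regular_def)
  have RBij: "r \<in> Bij ?S" if "r \<in> R" for r using perm_Bij[OF RB] that by blast
  have trans: "\<exists>r\<in>R. r \<one> = g" if "g \<in> ?S" for g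
  proof -
    have "g \<in> orbit (perm_group ?S R) (\<lambda>f. f) \<one>" using reg that by (simp add: regular_on_def)
    then show ?thesis by (auto simp: orbit_def)
  qed
  \<comment> \<open>If \<open>r\<close> and \<open>s\<close> agree at \<open>\<one>\<close>, then the quotient \<open>m\<close> of \<open>s\<close> by \<open>r\<close> lies in the trivial stabilizer of \<open>\<one>\<close>.\<close>
  have uniq: "r = s" if r: "r \<in> R" and s: "s \<in> R" and eq: "r \<one> = s \<one>" for r s
  proof -
    obtain h where h: "h \<in> R" "\<forall>x\<in>?S. h (r x) = x" "\<forall>x\<in>?S. r (h x) = x"
      using perm_inv[OF RB r] by blast
    obtain m where m: "m \<in> R" "\<forall>x\<in>?S. m x = h (s x)" using perm_mult[OF RB h(1) s] by blast
    have "m \<one> = \<one>" using m(2) h(2) eq by (metis one_closed)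
    then have "m \<in> stabilizer (perm_group ?S R) (\<lambda>f. f) \<one>" using m(1) by (simp add: stabilizer_def)
    then have "m = \<one>\<^bsub>?B\<^esub>" using reg by (simp add: regular_on_def)
    then have "h (s x) = x" if "x \<in> ?S" for x using m(2) that by (simp add: BijGroup_def)
    then have "r x = s x" if "x \<in> ?S" for x
      using h(3) Bij_app[OF RBij[OF s] that] that by metis
    then show ?thesis
      using RBij[OF r] RBij[OF s] by (intro extensionalityI[of _ ?S]) (auto simp: Bij_def)
  qed
  have comm: "r (s x) = s (r x)" if r: "r \<in> R" and s: "s \<in> R" and x: "x \<in> ?S" for r s x
  proof -
    interpret P: group "perm_group ?S R" by (rule subgroup.subgroup_is_group[OF RB group_BijGroup])
    interpret P: comm_group "perm_group ?S R"
      using iso_imp_comm_group[OF P.iso_sym[OF iso] P.is_monoid] .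
    have "r \<otimes>\<^bsub>?B\<^esub> s = s \<otimes>\<^bsub>?B\<^esub> r" using P.m_comm[of r s] r s by simp
    then show ?thesis using mult_BijGroup_app[OF RBij RBij x] r s by metis
  qed
  define c where "c g = (SOME r. r \<in> R \<and> r \<one> = g)" for g
  have c: "c g \<in> R" "c g \<one> = g" if "g \<in> ?S" for g
    using someI_ex[of "\<lambda>r. r \<in> R \<and> r \<one> = g"] trans[OF that] by (auto simp: c_def)
  have c_cl[simp]: "c g h \<in> ?S" if "g \<in> ?S" "h \<in> ?S" for g h
    using Bij_app[OF RBij[OF c(1)]] that by blast
  have c_comm: "c g h = c h g" if "g \<in> ?S" "h \<in> ?S" for g h
    using comm[OF c(1) c(1) one_closed] c(2) that by metis
  have c_assoc: "c (c g h) x = c g (c h x)" if "g \<in> ?S" "h \<in> ?S" "x \<in> ?S" for g h x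
  proof -
    obtain m where m: "m \<in> R" "\<forall>x\<in>?S. m x = c g (c h x)"
      using perm_mult[OF RB c(1) c(1)] \<open>g \<in> ?S\<close> \<open>h \<in> ?S\<close> by blast
    then have "m = c (c g h)" using that c by (intro uniq) auto
    then show ?thesis using m(2) that(3) by simp
  qed
  have c_aff: "c g (x \<otimes> y) = c g x \<otimes> (inv g \<otimes> c g y)" if "g \<in> ?S" "x \<in> ?S" "y \<in> ?S" for g x y
    using holomorph_affine[of "c g" x y] c[OF that(1)] that R(2) KH by auto
  define M where "M g h = inv g \<otimes> (inv h \<otimes> c g h)" for g h
  have M_cl[simp]: "M g h \<in> ?S" if "g \<in> ?S" "h \<in> ?S" for g h using that by (simp add: M_def)
  have cM: "c g h = g \<otimes> h \<otimes> M g h" if "g \<in> ?S" "h \<in> ?S" for g h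
  proof -
    have "g \<otimes> h \<otimes> M g h = (g \<otimes> inv g) \<otimes> ((h \<otimes> inv h) \<otimes> c g h)"
      unfolding M_def using that by (simp only: m_ac m_closed inv_closed c_cl)
    then show ?thesis using that by simp
  qed
  have M_sym: "M g h = M h g" if "g \<in> ?S" "h \<in> ?S" for g h
    using that c_comm[OF that] by (simp add: M_def m_ac)
  have M_add: "M g (x \<otimes> y) = M g x \<otimes> M g y" if "g \<in> ?S" "x \<in> ?S" "y \<in> ?S" for g x y
    using that by (simp add: M_def c_aff inv_mult m_ac)
  have M_assoc: "M (M g h) x = M g (M h x)" if S: "g \<in> ?S" "h \<in> ?S" "x \<in> ?S" for g h x
  proof -
    let ?A = "g \<otimes> h \<otimes> x \<otimes> M g h \<otimes> M g x \<otimes> M h x"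
    have "M (g \<otimes> h \<otimes> M g h) x = M g x \<otimes> M h x \<otimes> M (M g h) x"
      using S by (simp add: M_sym[of _ x] M_add)
    then have "c (c g h) x = ?A \<otimes> M (M g h) x"
      using S by (simp add: cM m_ac)
    moreover have "c g (c h x) = ?A \<otimes> M g (M h x)"
      using S by (simp add: cM M_add m_ac)
    ultimately show ?thesis using c_assoc[OF S] S by simp
  qed
  show ?thesis
  proof (rule that[of M])
    show "M g \<in> hom G G" if "g \<in> ?S" for g using that by (auto simp: hom_def M_add)
    show "h = \<one>" if S: "g \<in> ?S" "h \<in> ?S" and eq: "h \<otimes> M g h = \<one>" for g h
    proof -
      have "c g h = c g \<one>" using eq S c(2)[OF S(1)] by (simp add: cM[OF S] m_assoc)
      moreover have "inj_on (c g) ?S" using RBij[OF c(1)[OF S(1)]] by (simp add: Bij_def bij_betw_def)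
      ultimately show ?thesis using S by (auto dest: inj_onD)
    qed
    show "\<exists>k\<in>K. \<forall>z\<in>?S. k z = z \<otimes> M g z" if g: "g \<in> ?S" for g
    proof -
      have "(\<lambda>x\<in>?S. x \<otimes> inv g) \<in> right_translations G"
        using g by (auto simp: right_translations_def)
      moreover have "c g \<in> K" using c(1)[OF g] R(2) by blast
      ultimately obtain k where k: "k \<in> K" "\<forall>z\<in>?S. k z = (\<lambda>x\<in>?S. x \<otimes> inv g) (c g z)"
        using perm_mult[OF K] TK by blast
      have "k z = z \<otimes> M g z" if "z \<in> ?S" for z
      proof -
        have "k z = g \<otimes> (z \<otimes> M g z) \<otimes> inv g" using k(2) that g by (simp add: cM m_assoc)
        also have "\<dots> = (g \<otimes> inv g) \<otimes> (z \<otimes> M g z)"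
          using that g by (simp only: m_ac m_closed inv_closed M_cl)
        finally show ?thesis using that g by simp
      qed
      then show ?thesis using k(1) by blast
    qed
    show "R = right_translations G" if triv: "\<forall>g\<in>?S. \<forall>h\<in>?S. M g h = \<one>"
    proof -
      have ct: "c g = (\<lambda>x\<in>?S. x \<otimes> g)" if "g \<in> ?S" for g
        using RBij[OF c(1)[OF that]] that triv
        by (intro extensionalityI[of _ ?S]) (auto simp: Bij_def cM m_comm)
      have "R = c ` ?S"
      proof
        show "R \<subseteq> c ` ?S"
        proof
          fix r assume r: "r \<in> R"
          then have "r \<one> \<in> ?S" using Bij_app[OF RBij] by blast
          then show "r \<in> c ` ?S" using uniq[OF r c(1)] c(2) by auto
        qed
      qed (use c in auto)
      then show ?thesis using ct by (auto simp: right_translations_def)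
    qed
  qed (use M_sym M_assoc in auto)
qed

text \<open>
  Choose \<open>g\<close> with \<open>M g\<close> nonzero and with the largest kernel. The maps \<open>M g \<circ> M g\<close> and \<open>p \<cdot> M g\<close> are the
  multiplications by \<open>M g g\<close> and by \<open>g [^] p\<close>, and their kernels contain that of \<open>M g\<close>; so each of
  them is zero, or else has the same kernel as \<open>M g\<close>. The second alternative would make \<open>M g\<close>, respectively
  the \<open>p\<close>-th power map, injective on the image of \<open>M g\<close>. For the \<open>p\<close>-th power map this is excluded by the
  exponent of \<open>G\<close>. For \<open>M g\<close> it is excluded by quasi-regularity: two powers of \<open>g\<close> in the ring
  coincide, and cancelling between them produces an element \<open>e\<close> with \<open>M e u = u\<close> for some \<open>u \<noteq> \<one>\<close>,
  so that \<open>u \<otimes> M (inv e) u = \<one>\<close>.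
\<close>

lemma (in comm_group) exists_square_zero_multiplication:
  fixes M :: "'a \<Rightarrow> 'a \<Rightarrow> 'a" and p n :: nat
  assumes fin: "finite (carrier G)" and expo: "\<And>x. x \<in> carrier G \<Longrightarrow> x [^] (p ^ n) = \<one>"
    and M: "\<And>g. g \<in> carrier G \<Longrightarrow> M g \<in> hom G G"
    and sym: "\<And>g h. g \<in> carrier G \<Longrightarrow> h \<in> carrier G \<Longrightarrow> M g h = M h g"
    and assoc: "\<And>g h x. g \<in> carrier G \<Longrightarrow> h \<in> carrier G \<Longrightarrow> x \<in> carrier G \<Longrightarrow>
                  M (M g h) x = M g (M h x)"
    and quasi: "\<And>g h. g \<in> carrier G \<Longrightarrow> h \<in> carrier G \<Longrightarrow> h \<otimes> M g h = \<one> \<Longrightarrow> h = \<one>"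
    and nontriv: "g0 \<in> carrier G" "h0 \<in> carrier G" "M g0 h0 \<noteq> \<one>"
  shows "\<exists>g\<in>carrier G. (\<exists>h\<in>carrier G. M g h \<noteq> \<one>) \<and>
           (\<forall>z\<in>carrier G. M g (M g z) = \<one> \<and> M g z [^] p = \<one>)"
proof -
  let ?S = "carrier G"
  have cl[simp]: "M g h \<in> ?S" if "g \<in> ?S" "h \<in> ?S" for g h
    using hom_in_carrier[OF M] that by blast
  have M1[simp]: "M g \<one> = \<one>" if "g \<in> ?S" for g
    using hom_one[OF M[OF that] is_group is_group] .
  have gh: "group_hom G G (M g)" if "g \<in> ?S" for g
    using M[OF that] by (simp add: group_hom_def group_hom_axioms_def is_group)
  define A where "A = {g \<in> ?S. \<exists>h\<in>?S. M g h \<noteq> \<one>}"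
  define ker where "ker g = {h \<in> ?S. M g h = \<one>}" for g
  have "finite A" "A \<noteq> {}" using fin nontriv by (auto simp: A_def)
  then obtain g where gA: "g \<in> A" and gmax: "\<And>g'. g' \<in> A \<Longrightarrow> card (ker g') \<le> card (ker g)"
    using obtains_MAX[of A "\<lambda>g. card (ker g)"]
    by (metis (no_types, lifting) Max_ge finite_imageI imageI)
  then have g: "g \<in> ?S" by (simp add: A_def)
  obtain h where h: "h \<in> ?S" "M g h \<noteq> \<one>" using gA by (auto simp: A_def)
  have max: "M g z = \<one>"
    if "g' \<in> A" "ker g \<subseteq> ker g'" "z \<in> ?S" "M g' z = \<one>" for g' z
  proof -
    have "finite (ker g')" using fin by (simp add: ker_def)
    then have "ker g = ker g'" using card_seteq[OF _ that(2) gmax[OF that(1)]] by blast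
    then show ?thesis using that(3,4) by (auto simp: ker_def)
  qed
  have sq: "M g (M g z) = \<one>" if z: "z \<in> ?S" for z
  proof (rule ccontr)
    assume nz: "M g (M g z) \<noteq> \<one>"
    have gg: "M g g \<in> A" using nz z g assoc by (auto simp: A_def)
    have "ker g \<subseteq> ker (M g g)" using g assoc by (auto simp: ker_def)
    then have "M g u = \<one>" if "u \<in> ?S" "M g (M g u) = \<one>" for u
      using max[OF gg _ that(1)] that assoc g by simp
    then have can: "M g u = M g v" if "u \<in> ?S" "v \<in> ?S" "M g (M g u) = M g (M g v)" for u v
    proof -
      have "M g (M g (u \<otimes> inv v)) = \<one>" and *: "M g (u \<otimes> inv v) = M g u \<otimes> inv (M g v)"
        using that g by (simp_all add: hom_mult[OF M[OF g]] group_hom.hom_inv[OF gh[OF g]])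
      then have "M g u \<otimes> inv (M g v) = \<one>"
        using \<open>\<And>u. u \<in> ?S \<Longrightarrow> M g (M g u) = \<one> \<Longrightarrow> M g u = \<one>\<close>[of "u \<otimes> inv v"] that by simp
      then show ?thesis using that g by (metis cl inv_equality inv_inv inv_closed)
    qed
    \<comment> \<open>\<open>E i\<close> is the \<open>(i + 1)\<close>-st power of \<open>g\<close> for the multiplication \<open>M\<close>.\<close>
    define E where "E i = (M g ^^ i) g" for i
    have it: "(M g ^^ i) u \<in> ?S" if "u \<in> ?S" for u i
      by (induction i) (use that g in auto)
    have E: "M (E i) u = (M g ^^ Suc i) u" if "u \<in> ?S" for u i
      unfolding E_def by (induction i) (use that g it assoc in auto)
    have ES: "E i \<in> ?S" for i using it[OF g] by (simp add: E_def)
    have "\<not> inj E"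
      using fin ES finite_subset[of "range E" ?S] finite_imageD[of E UNIV] by auto
    then obtain i j where ij: "i < j" "E i = E j"
      unfolding inj_def by (metis linorder_neqE_nat)
    define d where "d = j - Suc i"
    have j: "Suc j = Suc i + Suc d" using ij(1) by (simp add: d_def)
    have cann: "M g u = M g v" if "u \<in> ?S" "v \<in> ?S" "(M g ^^ Suc i) u = (M g ^^ Suc i) v" for u v i
      using that(3) by (induction i) (use can[OF it it] that(1,2) in auto)
    have "(M g ^^ Suc i) h = (M g ^^ Suc j) h" using E[OF h(1)] ij(2) by metis
    also have "\<dots> = (M g ^^ Suc i) ((M g ^^ Suc d) h)" unfolding j funpow_add by simp
    finally have "M g h = M g ((M g ^^ Suc d) h)" by (rule cann[OF h(1) it[OF h(1)]])
    also have "\<dots> = M (E d) (M g h)" using E g h(1) by (simp add: funpow_swap1)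
    finally have "M g h \<otimes> M (inv (E d)) (M g h) = \<one>"
      using g h ES by (simp add: sym[of "inv (E d)"] group_hom.hom_inv[OF gh] sym[of _ "E d"])
    then have "M g h = \<one>" using quasi[of "inv (E d)" "M g h"] g h ES by simp
    then show False using h(2) by simp
  qed
  have Mp: "M (g [^] p) z = M g z [^] p" if "z \<in> ?S" for z
    using sym[of "g [^] p" z] sym[of g z] group_hom.hom_nat_pow[OF gh[OF that] g] that g by simp
  have "M g z [^] p = \<one>" if z: "z \<in> ?S" for z
  proof (rule ccontr)
    assume "M g z [^] p \<noteq> \<one>"
    then have gp: "g [^] p \<in> A" using Mp z g by (auto simp: A_def)
    have "ker g \<subseteq> ker (g [^] p)" using g Mp by (auto simp: ker_def)
    then have *: "M g u = \<one>" if "u \<in> ?S" "M g u [^] p = \<one>" for u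
      using max[OF gp _ that(1)] Mp that by simp
    have "M g u [^] (p ^ m) = \<one> \<Longrightarrow> M g u = \<one>" if "u \<in> ?S" for u m
    proof (induction m)
      case (Suc m)
      have "M g (u [^] (p ^ m)) = M g u [^] (p ^ m)"
        using group_hom.hom_nat_pow[OF gh[OF g]] that by simp
      then show ?case
        using Suc *[of "u [^] (p ^ m)"] that g by (simp add: nat_pow_pow mult.commute)
    qed (use that g in simp)
    then show False using expo[of "M g h"] h g by auto
  qed
  then show ?thesis using g h sq by blast
qed

section \<open>Square-zero endomorphisms have rank one\<close>

lemma (in group) pow_multiple_eq_one:
  fixes m n :: nat
  shows "x \<in> carrier G \<Longrightarrow> x [^] m = \<one> \<Longrightarrow> m dvd n \<Longrightarrow> x [^] n = \<one>"
  by (auto simp: pow_eq_id dest: dvd_trans)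

lemma (in group) power_in_powers:
  fixes x y :: 'a and p m i :: nat
  assumes x: "x \<in> carrier G" "x [^] p = \<one>" and y: "y \<in> carrier G"
    and p: "Factorial_Ring.prime p" "\<not> p dvd m" and eq: "x [^] m = y [^] i"
  shows "\<exists>j::nat. x = y [^] j"
proof -
  have "gcd m p = 1" using p by (metis coprime_commute coprime_iff_gcd_eq_1 prime_imp_coprime)
  moreover have "m \<noteq> 0" using p(2) by (metis dvd_0_right)
  ultimately obtain c d where "m * c = p * d + 1" using bezout_nat[of m p] by metis
  then have "x [^] (m * c) = x" using x by (simp add: nat_pow_mult[symmetric] nat_pow_pow[symmetric])
  moreover have "x [^] (m * c) = y [^] (i * c)" using x y eq by (simp add: nat_pow_pow[symmetric])
  ultimately show ?thesis by metis
qed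

text \<open>
  Put \<open>a = N e\<^sub>1\<close>, \<open>b = N e\<^sub>2\<close>, \<open>Q = p\<^bsup>k-1\<^esup>\<close> and \<open>q = e\<^sub>1\<^bsup>Q\<^esup>\<close>. If \<open>b = \<one>\<close>, the image of \<open>N\<close> is generated by
  \<open>a\<close>. Otherwise it is generated by \<open>b\<close>: both \<open>a\<close> and \<open>b\<close> have order dividing \<open>p\<close>, so they
  are products of powers of \<open>q\<close> and \<open>e\<^sub>2\<close>, and applying \<open>N\<close> to these expressions gives, as \<open>N\<^sup>2 = 0\<close>,
  two relations between \<open>a\<^bsup>Q\<^esup>\<close> and \<open>b\<close>. Either the relation coming from \<open>b\<close> has an exponent of
  \<open>a\<close> prime to \<open>p\<close> and expresses \<open>a\<close> by \<open>b\<close>, or the relations force \<open>a\<close> and \<open>b\<close> into the group of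
  order \<open>p\<close> generated by \<open>q\<close>.
\<close>

lemma (in comm_group) square_zero_endo_rank_one:
  fixes p k :: nat
  assumes p: "Factorial_Ring.prime p" and k: "k \<ge> 1"
    and e1: "e1 \<in> carrier G" "ord e1 = p ^ k" and e2: "e2 \<in> carrier G" "e2 [^] p = \<one>"
    and gen: "\<And>v. v \<in> carrier G \<Longrightarrow> \<exists>(i::nat) (j::nat). v = e1 [^] i \<otimes> e2 [^] j"
    and N: "N \<in> hom G G" and NN: "\<And>z. z \<in> carrier G \<Longrightarrow> N (N z) = \<one>"
    and Np: "\<And>z. z \<in> carrier G \<Longrightarrow> N z [^] p = \<one>"
  shows "\<exists>w\<in>carrier G. w [^] p = \<one> \<and> (\<forall>v\<in>carrier G. \<exists>l::nat. N v = w [^] l)"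
proof -
  interpret N: group_hom G G N using N by (simp add: group_hom_def group_hom_axioms_def is_group)
  define a b where ab: "a = N e1" "b = N e2"
  have S: "a \<in> carrier G" "b \<in> carrier G" using e1 e2 by (auto simp: ab)
  have abp: "a [^] p = \<one>" "b [^] p = \<one>" using e1 e2 Np by (auto simp: ab)
  have Nv: "\<exists>(i::nat) (j::nat). N v = a [^] i \<otimes> b [^] j" if "v \<in> carrier G" for v
  proof -
    obtain i j :: nat where "v = e1 [^] i \<otimes> e2 [^] j" using gen[OF \<open>v \<in> carrier G\<close>] by blast
    then have "N v = a [^] i \<otimes> b [^] j" using e1 e2 by (simp add: ab N.hom_nat_pow)
    then show ?thesis by blast
  qed
  show ?thesis
  proof (cases "b = \<one>")
    case True
    then have "\<exists>l::nat. N v = a [^] l" if "v \<in> carrier G" for v using Nv[OF that] S by auto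
    then show ?thesis using S abp by blast
  next
    case b: False
    have pdvd: "p dvd m" if "b [^] m = \<one>" for m
      using power_in_powers[of b p \<one> m 0] that b S abp p by auto
    define Q where "Q = p ^ (k - 1)"
    define q where "q = e1 [^] Q"
    have q: "q \<in> carrier G" "q [^] p = \<one>" "N q = a [^] Q"
    proof -
      have "Q * p = p ^ k" using k by (simp add: Q_def flip: power_Suc2)
      then show "q [^] p = \<one>" using e1 by (simp add: q_def nat_pow_pow pow_eq_id)
    qed (use e1 in \<open>auto simp: q_def ab N.hom_nat_pow\<close>)
    \<comment> \<open>The elements of order dividing \<open>p\<close> form the group generated by \<open>q\<close> and \<open>e2\<close>.\<close>
    have Omega: "\<exists>(s::nat) (t::nat). x = q [^] s \<otimes> e2 [^] t" if x: "x \<in> carrier G" "x [^] p = \<one>" for x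
    proof -
      obtain i j :: nat where ij: "x = e1 [^] i \<otimes> e2 [^] j" using gen[OF x(1)] by blast
      have "(e2 [^] j) [^] p = \<one>" using e2 by (metis mult.commute nat_pow_one nat_pow_pow)
      then have "e1 [^] (i * p) = \<one>"
        using x(2) e1 e2 by (simp add: ij nat_pow_distrib nat_pow_pow)
      then have "p ^ k dvd i * p" using e1 pow_eq_id by metis
      moreover have "p ^ k = Q * p" using k by (simp add: Q_def flip: power_Suc2)
      ultimately have "Q dvd i" using p by (simp add: prime_gt_0_nat)
      then obtain s where "i = Q * s" by blast
      then show ?thesis using ij e1 by (auto simp: q_def nat_pow_pow)
    qed
    have rel: "(a [^] Q) [^] s \<otimes> b [^] t = \<one>"
      if "z \<in> carrier G" "N z = q [^] s \<otimes> e2 [^] t" for z and s t :: nat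
      using NN[OF that(1)] that q e2 by (simp add: N.hom_nat_pow ab)
    obtain s t :: nat where st: "a = q [^] s \<otimes> e2 [^] t" using Omega[of a] S abp by blast
    obtain s' t' :: nat where st': "b = q [^] s' \<otimes> e2 [^] t'" using Omega[of b] S abp by blast
    have r: "(a [^] Q) [^] s \<otimes> b [^] t = \<one>" "(a [^] Q) [^] s' \<otimes> b [^] t' = \<one>"
      using rel e1 e2 st st' by (auto simp: ab)
    note e2p = pow_multiple_eq_one[OF e2]
    have "\<exists>c::nat. a = b [^] c"
    proof (cases "p dvd Q * s'")
      case False
      have "a [^] (Q * s') = b [^] ((p - 1) * t')"
      proof -
        have "b [^] ((p - 1) * t') \<otimes> b [^] t' = \<one>"
        proof -
          have "(p - 1) * t' + t' = p * t'" using prime_gt_0_nat[OF p] by (cases p) auto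
          then have "b [^] ((p - 1) * t') \<otimes> b [^] t' = (b [^] p) [^] t'"
            using S by (simp only: nat_pow_mult nat_pow_pow)
          then show ?thesis using abp by simp
        qed
        then show ?thesis using r(2) S by (simp add: nat_pow_pow) (metis S nat_pow_closed right_cancel)
      qed
      then show ?thesis using power_in_powers[OF S(1) abp(1) S(2) p False] by blast
    next
      case True
      then have "a [^] (Q * s') = \<one>" by (rule pow_multiple_eq_one[OF S(1) abp(1)])
      then have "b [^] t' = \<one>" using r(2) S by (simp add: nat_pow_pow)
      then have bq: "b = q [^] s'" using st' q e2p[OF pdvd] by simp
      have ns: "\<not> p dvd s'" using bq b pow_multiple_eq_one[OF q(1,2)] by blast
      then have "p dvd Q" using True p by (simp add: prime_dvd_mult_iff)
      then have "a [^] Q = \<one>" by (rule pow_multiple_eq_one[OF S(1) abp(1)])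
      then have "b [^] t = \<one>" using r(1) S by simp
      then have aq: "a = q [^] s" using st q e2p[OF pdvd] by simp
      obtain c :: nat where "q = b [^] c"
        using power_in_powers[OF q(1,2) S(2) p ns, of 1] bq S by auto
      then show ?thesis using aq S by (auto simp: nat_pow_pow)
    qed
    then obtain c :: nat where "a = b [^] c" by blast
    then have "\<exists>l::nat. N v = b [^] l" if "v \<in> carrier G" for v
      using Nv[OF that] S by (auto simp: nat_pow_pow nat_pow_mult)
    then show ?thesis using S abp by blast
  qed
qed

section \<open>The two families of groups\<close>

text \<open>The cyclic groups are covered by the choice \<open>e\<^sub>2 = \<one>\<close>.\<close>

lemma (in comm_group) NCI2_two_generators:
  fixes p k :: nat
  assumes p: "Factorial_Ring.prime p" "odd p" and k: "k \<ge> 1" and fin: "finite (carrier G)"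
    and e1: "e1 \<in> carrier G" "ord e1 = p ^ k" and e2: "e2 \<in> carrier G" "e2 [^] p = \<one>"
    and gen: "\<And>v. v \<in> carrier G \<Longrightarrow> \<exists>(i::nat) (j::nat). v = e1 [^] i \<otimes> e2 [^] j"
  shows "NCI2_group G"
proof -
  let ?S = "carrier G" and ?B = "BijGroup (carrier G)" and ?T = "right_translations G"
  interpret B: group ?B by (rule group_BijGroup)
  have expo: "x [^] (p ^ k) = \<one>" if "x \<in> ?S" for x
  proof -
    obtain i j :: nat where x: "x = e1 [^] i \<otimes> e2 [^] j"
      using gen[OF \<open>x \<in> ?S\<close>] by blast
    have "e1 [^] (i * p ^ k) = \<one>" using e1 by (simp add: pow_eq_id)
    moreover have "e2 [^] (j * p ^ k) = \<one>"
      by (rule pow_multiple_eq_one[OF e2]) (use k in \<open>simp add: dvd_power\<close>)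
    ultimately show ?thesis using e1 e2 by (simp add: x nat_pow_distrib nat_pow_pow)
  qed
  have "R = ?T"
    if K: "subgroup K ?B" and closed: "two_closed ?S K" and TK: "?T \<subseteq> K" and KH: "K \<subseteq> holomorph G"
      and R: "G_regular G R" "R \<subseteq> K" for K R
  proof -
    obtain M where M: "\<And>g. g \<in> ?S \<Longrightarrow> M g \<in> hom G G"
      and sym: "\<And>g h. g \<in> ?S \<Longrightarrow> h \<in> ?S \<Longrightarrow> M g h = M h g"
      and assoc: "\<And>g h x. g \<in> ?S \<Longrightarrow> h \<in> ?S \<Longrightarrow> x \<in> ?S \<Longrightarrow> M (M g h) x = M g (M h x)"
      and quasi: "\<And>g h. g \<in> ?S \<Longrightarrow> h \<in> ?S \<Longrightarrow> h \<otimes> M g h = \<one> \<Longrightarrow> h = \<one>"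
      and MK: "\<And>g. g \<in> ?S \<Longrightarrow> \<exists>k\<in>K. \<forall>z\<in>?S. k z = z \<otimes> M g z"
      and triv: "(\<forall>g\<in>?S. \<forall>h\<in>?S. M g h = \<one>) \<Longrightarrow> R = ?T"
      using regular_subgroup_radical_ring[OF K TK KH R] by blast
    show "R = ?T"
    proof (rule triv, rule ccontr)
      assume "\<not> (\<forall>g\<in>?S. \<forall>h\<in>?S. M g h = \<one>)"
      then obtain g0 h0 where nontriv: "g0 \<in> ?S" "h0 \<in> ?S" "M g0 h0 \<noteq> \<one>" by blast
      have "\<exists>g\<in>?S. (\<exists>h\<in>?S. M g h \<noteq> \<one>) \<and> (\<forall>z\<in>?S. M g (M g z) = \<one> \<and> M g z [^] p = \<one>)"
        by (rule exists_square_zero_multiplication[of p k M g0 h0])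
          (fact fin expo M sym assoc quasi nontriv)+
      then obtain g h where g: "g \<in> ?S" and h: "h \<in> ?S" "M g h \<noteq> \<one>"
        and sq: "\<And>z. z \<in> ?S \<Longrightarrow> M g (M g z) = \<one>" and Mp: "\<And>z. z \<in> ?S \<Longrightarrow> M g z [^] p = \<one>"
        by blast
      have "\<exists>w\<in>?S. w [^] p = \<one> \<and> (\<forall>v\<in>?S. \<exists>l::nat. M g v = w [^] l)"
        by (rule square_zero_endo_rank_one[OF p(1) k e1 e2 gen M[OF g] sq Mp])
      then obtain w and lam :: "'a \<Rightarrow> nat" where w: "w \<in> ?S" "w [^] p = \<one>"
        and lam: "\<And>v. v \<in> ?S \<Longrightarrow> M g v = w [^] lam v" by metis
      have "M g h = \<one>"
        by (rule no_square_zero_rank_one_shear[OF fin p K TK KH closed M[OF g] sq MK[OF g] w lam h(1)])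
      then show False using h(2) by simp
    qed
  qed
  moreover have "conjugate_in ?B K ?T ?T" if "subgroup K ?B" for K
  proof -
    have "?T \<subseteq> carrier ?B"
      using right_translation_Bij by (auto simp: right_translations_def BijGroup_def)
    then have "?T = \<one>\<^bsub>?B\<^esub> <#\<^bsub>?B\<^esub> ?T #>\<^bsub>?B\<^esub> inv\<^bsub>?B\<^esub> \<one>\<^bsub>?B\<^esub>"
      by (simp add: B.lcos_mult_one)
    then show ?thesis
      unfolding conjugate_in_def
      by (intro bexI[of _ "\<one>\<^bsub>?B\<^esub>"]) (use subgroup.one_closed[OF that] in blast)+
  qed
  ultimately show ?thesis
    using fin is_group by (auto simp: NCI2_group_def transjugate_def)
qed

lemma pow_DirProd: "(x, y) [^]\<^bsub>G \<times>\<times> H\<^esub> (n::nat) = (x [^]\<^bsub>G\<^esub> n, y [^]\<^bsub>H\<^esub> n)"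
  by (induction n) auto

lemma NCI2_cyclic:
  fixes p k :: nat
  assumes p: "Factorial_Ring.prime p" "odd p" and k: "k \<ge> 1"
  shows "NCI2_group (integer_mod_group (p ^ k))"
proof -
  let ?G = "integer_mod_group (p ^ k)"
  have pk: "p ^ k > 1" "p > 1"
    using one_less_power[OF prime_gt_1_nat[OF p(1)]] prime_gt_1_nat[OF p(1)] k by simp_all
  interpret comm_group ?G by simp
  have car: "carrier ?G = {0..<int (p ^ k)}" using pk by (simp add: carrier_integer_mod_group)
  have "\<exists>(i::nat) (j::nat). v = 1 [^]\<^bsub>?G\<^esub> i \<otimes>\<^bsub>?G\<^esub> 0 [^]\<^bsub>?G\<^esub> j" if "v \<in> carrier ?G" for v
    using that by (intro exI[of _ "nat v"] exI[of _ 0]) (auto simp: car)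
  moreover have "ord (1::int) = p ^ k"
    using pk by (subst ord_unique) (auto simp: car simp del: of_nat_power simp flip: of_nat_mod)
  ultimately show ?thesis
    by (intro NCI2_two_generators[OF p k, of 1 0]) (use pk in \<open>auto simp: car simp del: of_nat_power\<close>)
qed

lemma NCI2_cyclic_times_prime:
  fixes p k :: nat
  assumes p: "Factorial_Ring.prime p" "odd p" and k: "k \<ge> 1"
  shows "NCI2_group (integer_mod_group (p ^ k) \<times>\<times> integer_mod_group p)"
proof -
  let ?C = "integer_mod_group (p ^ k)" and ?D = "integer_mod_group p"
  let ?G = "?C \<times>\<times> ?D"
  have pk: "p ^ k > 1" "p > 1"
    using one_less_power[OF prime_gt_1_nat[OF p(1)]] prime_gt_1_nat[OF p(1)] k by simp_all
  interpret comm_group ?G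
    by (rule group.group_comm_groupI[OF DirProd_group]) (auto simp: add.commute)
  have car: "carrier ?C = {0..<int (p ^ k)}" "carrier ?D = {0..<int p}"
    using pk by (simp_all add: carrier_integer_mod_group)
  have "\<exists>(i::nat) (j::nat). v = (1, 0) [^]\<^bsub>?G\<^esub> i \<otimes>\<^bsub>?G\<^esub> (0, 1) [^]\<^bsub>?G\<^esub> j" if "v \<in> carrier ?G" for v
    using that by (intro exI[of _ "nat (fst v)"] exI[of _ "nat (snd v)"])
      (auto simp: car pow_DirProd)
  moreover have "ord (1::int, 0::int) = p ^ k"
    using pk by (subst ord_unique) (auto simp: car pow_DirProd simp del: of_nat_power simp flip: of_nat_mod)
  ultimately show ?thesis
    by (intro NCI2_two_generators[OF p k, of "(1, 0)" "(0, 1)"])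
      (use pk in \<open>auto simp: car pow_DirProd simp del: of_nat_power\<close>)
qed

theorem theorem1p3:
  fixes p k :: nat
  assumes "Factorial_Ring.prime p" and "odd p" and "k \<ge> 1"
  shows "NCI2_group (integer_mod_group (p ^ k)) \<and>
         NCI2_group (integer_mod_group (p ^ k) \<times>\<times> integer_mod_group p)"
  using NCI2_cyclic[OF assms] NCI2_cyclic_times_prime[OF assms] by blast

end
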